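(* Let $K$ be a field of characteristic $0$. Each of the following claims (i) and (ii) is equivalent to the Jacobian conjecture for $K[x,y]$, i.e. to the claim that $K[p,q]=K[x,y]$ for every Jacobian pair $(p,q)$ in $K[x,y]$: (i) for every Jacobian pair $(p,q)$ in $K[x,y]$ there is a coordinate polynomial $g \in K[x,y]$ such that $K[x,y] = K[p] + \langle g\rangle$; (ii) for every Jacobian pair $(p,q)$ in $K[x,y]$ there is a coordinate polynomial $g\in K[x,y]$ such that $K[x,y] = K[g] + \langle p\rangle$.
   Context: A pair $(p,q)$ of polynomials in $K[x,y]$ is a Jacobian pair if its $2\times 2$ Jacobian matrix of partial derivatives with respect to $x,y$ is invertible over $K[x,y]$. A polynomial $g\in K[x,y]$ is a coordinate polynomial if $K[g,h]=K[x,y]$ for some $h\in K[x,y]$. $\langle f\rangle$ denotes the ideal of $K[x,y]$ generated by $f$, and $K[f]$, $K[f,h]$ denote the $K$-subalgebras generated by the indicated polynomials. Sums are sums of $K$-subspaces (not assumed direct). *)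

theory Defs
  imports
    "HOL-Analysis.Analysis"
    "HOL-Computational_Algebra.Polynomial"
    "HOL-Library.Set_Algebras"
begin

text \<open>
  The polynomial ring \<open>K[x,y]\<close> over a field \<open>K\<close> is rendered as \<open>K[x][y]\<close>, that is, as the
  type \<open>'a poly poly\<close>: the inner variable is \<open>x = [:[:0, 1:]:]\<close>, the outer variable is
  \<open>y = [:0, 1:]\<close>, and \<open>c \<in> K\<close> is embedded as the constant \<open>[:[:c:]:]\<close>.
  The sum \<open>A + B\<close> of two \<open>K\<close>-subspaces is the elementwise sum of sets.
\<close>

text \<open>Differentiating with respect to \<open>x\<close> acts on each coefficient (a polynomial in \<open>x\<close>).\<close>

definition partial_x :: "'a::field poly poly \<Rightarrow> 'a poly poly"
  where "partial_x f = map_poly pderiv f"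

definition partial_y :: "'a::field poly poly \<Rightarrow> 'a poly poly"
  where "partial_y f = pderiv f"

definition jacobian_mat :: "'a::field poly poly \<Rightarrow> 'a poly poly \<Rightarrow> 'a poly poly ^ 2 ^ 2"
  where "jacobian_mat p q =
    vector [vector [partial_x p, partial_y p],
            vector [partial_x q, partial_y q]]"

text \<open>Here \<^const>\<open>invertible\<close> asks for an inverse matrix with entries in \<open>K[x,y]\<close>.\<close>

definition jacobian_pair :: "'a::field poly poly \<Rightarrow> 'a poly poly \<Rightarrow> bool"
  where "jacobian_pair p q \<longleftrightarrow> invertible (jacobian_mat p q)"

definition subalgebra :: "'a::field poly poly set \<Rightarrow> bool"
  where "subalgebra A \<longleftrightarrow>
    (\<forall>c. [:[:c:]:] \<in> A) \<and>
    (\<forall>f\<in>A. \<forall>g\<in>A. f + g \<in> A) \<and>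
    (\<forall>f\<in>A. \<forall>g\<in>A. f * g \<in> A)"

text \<open>
  \<open>adjoin {f}\<close> is \<open>K[f]\<close> and \<open>adjoin {f, h}\<close> is \<open>K[f,h]\<close>.
\<close>

definition adjoin :: "'a::field poly poly set \<Rightarrow> 'a poly poly set"
  where "adjoin S = subalgebra hull S"

definition coordinate_polynomial :: "'a::field poly poly \<Rightarrow> bool"
  where "coordinate_polynomial g \<longleftrightarrow> (\<exists>h. adjoin {g, h} = UNIV)"

text \<open>Ideals are the submodules of the ring regarded as a module over itself.\<close>

definition ideal_generated :: "'a::field poly poly \<Rightarrow> 'a poly poly set"
  where "ideal_generated f = module.span (*) {f}"

lemma ideal_generated_eq: "ideal_generated f = range (\<lambda>h. h * f)"
proof -
  interpret module "(*) :: 'a poly poly \<Rightarrow> _"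
    by unfold_locales (simp_all add: algebra_simps)
  show ?thesis
    by (simp add: ideal_generated_def span_singleton)
qed

end

theory Submission
  imports Defs
begin

text \<open>
  A pair \<open>g, h\<close> with \<open>K[g,h] = K[x,y]\<close> is as good as the pair \<open>x, y\<close>: the substitution
  \<open>x \<mapsto> g, y \<mapsto> h\<close> is onto, the chain rule makes the Jacobian determinant of \<open>(g,h)\<close> a unit
  (\<open>jac_generators\<close>), and then the substitution is injective, because its kernel is closed
  under both partial derivatives and contains no nonzero constant (\<open>inj_subst2\<close>). So a
  Jacobian pair may be rewritten in any such coordinates (\<open>jac_transport\<close>).

  If \<open>K[p,q] = K[x,y]\<close>, then \<open>F(p,q) - F(p,0)\<close> is a multiple of \<open>q\<close> and \<open>F(p,q) - F(0,q)\<close> is a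
  multiple of \<open>p\<close>; hence \<open>g = q\<close> serves both claims.

  Suppose conversely that \<open>K[x,y] = K[p] + \<langle>g\<rangle>\<close>. In coordinates where \<open>g\<close> becomes \<open>y\<close>, restricting
  to the line \<open>y = 0\<close> shows that \<open>p(x,0)\<close> generates \<open>K[x]\<close>, so it is linear; subtracting from
  \<open>q\<close> a polynomial in \<open>p\<close> one may assume \<open>q(x,0) = 0\<close>, and then the coefficient of \<open>y\<close> in
  \<open>q\<close>, as a polynomial in \<open>y\<close> over \<open>K[x]\<close>, is a nonzero constant. Now compare the Newton polygons of \<open>p\<close> and \<open>q\<close> with the monomials \<open>x\<close>
  and \<open>y\<close>. If some monomial of \<open>p\<close> other than \<open>x\<close> had positive degree in \<open>x\<close>, or \<open>q\<close> had
  any monomial beyond \<open>y\<close>, then, after identifying the base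
  points \<open>x\<close> and \<open>y\<close> of the two polygons, some edge of one of them would leave the base point
  towards such a monomial and lie on a supporting line of both. The far ends of the two
  polygons on this line (one of which may be the base point) contribute a monomial to the Jacobian
  determinant whose coefficient is a positive integer multiple of a product of nonzero
  coefficients, and which is not constant: a contradiction in characteristic 0
  (\<open>jac_edge\<close>). Therefore \<open>p = a x + B(y)\<close> and \<open>q = d y\<close>, a triangular
  automorphism.

  Suppose finally that \<open>K[x,y] = K[g] + \<langle>p\<rangle>\<close>. In coordinates where \<open>g\<close> becomes \<open>x\<close>, this gives
  \<open>y = r(x) + s p\<close>. Since \<open>y - r(x)\<close> is irreducible and \<open>p\<close> is not constant, \<open>s\<close> is a
  constant, so \<open>p\<close> itself is a coordinate completing \<open>g\<close>. In the coordinates \<open>(g,p)\<close> the Jacobian condition says that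
  \<open>\<partial>q/\<partial>g\<close> is a nonzero constant, and again \<open>(q,p)\<close> is triangular over \<open>(g,p)\<close>.
\<close>

section \<open>Substitution into bivariate polynomials\<close>

abbreviation scal :: "'a::field \<Rightarrow> 'a poly poly" where "scal c \<equiv> [:[:c:]:]"
abbreviation var_x :: "'a::field poly poly" where "var_x \<equiv> [:[:0, 1:]:]"
abbreviation var_y :: "'a::field poly poly" where "var_y \<equiv> [:0, 1:]"

text \<open>
  The ring \<open>K[x,y]\<close> is generated by the constants and the two variables, so a statement that
  survives sums and products, such as the chain rule, needs to be checked on these only.
\<close>

lemma bivariate_poly_induct [case_names scal var_x var_y add mult]:
  fixes F :: "'a::field poly poly"
  assumes scal: "\<And>c. P (scal c)" and x: "P var_x" and y: "P var_y"
    and add: "\<And>F G. P F \<Longrightarrow> P G \<Longrightarrow> P (F + G)"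
    and mult: "\<And>F G. P F \<Longrightarrow> P G \<Longrightarrow> P (F * G)"
  shows "P F"
proof -
  have inner: "P [:r:]" for r :: "'a poly"
  proof (induction r)
    case 0
    show ?case using scal[of 0] by simp
  next
    case (pCons c r)
    have "[:pCons c r:] = scal c + var_x * [:r:]" by simp
    then show ?case using add[OF scal mult[OF x pCons.IH]] by simp
  qed
  show ?thesis
  proof (induction F)
    case 0
    show ?case using scal[of 0] by simp
  next
    case (pCons r F)
    have "pCons r F = [:r:] + var_y * F" by simp
    then show ?case using add[OF inner mult[OF y pCons.IH]] by simp
  qed
qed

text \<open>
  For \<open>r \<in> K[t]\<close> and \<open>F \<in> K[x,y]\<close>, \<open>subst1 a r\<close> is \<open>r(a)\<close> and \<open>subst2 a b F\<close> is \<open>F(a,b)\<close>.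
\<close>

definition subst1 :: "'a::field poly poly \<Rightarrow> 'a poly \<Rightarrow> 'a poly poly"
  where "subst1 a r = poly (map_poly scal r) a"

definition subst2 :: "'a::field poly poly \<Rightarrow> 'a poly poly \<Rightarrow> 'a poly poly \<Rightarrow> 'a poly poly"
  where "subst2 a b F = poly (map_poly (subst1 a) F) b"

lemma subst1_0 [simp]: "subst1 a 0 = 0"
  by (simp add: subst1_def)

lemma subst1_pCons [simp]: "subst1 a (pCons c r) = scal c + a * subst1 a r"
  by (simp add: subst1_def map_poly_pCons)

lemma subst2_0 [simp]: "subst2 a b 0 = 0"
  by (simp add: subst2_def)

lemma subst2_pCons [simp]: "subst2 a b (pCons r F) = subst1 a r + b * subst2 a b F"
  by (simp add: subst2_def map_poly_pCons)

lemma subst_1 [simp]: "subst1 a 1 = 1" "subst2 a b 1 = 1"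
proof -
  show "subst1 a 1 = 1"
    using subst1_pCons[of a 1 0] by (simp add: pCons_one)
  then show "subst2 a b 1 = 1"
    using subst2_pCons[of a b 1 0] by (simp add: pCons_one)
qed

lemma subst1_add: "subst1 a (r + s) = subst1 a r + subst1 a s"
  by (induction r s rule: poly_induct2) (simp_all add: algebra_simps)

lemma subst1_smult: "subst1 a (smult c r) = scal c * subst1 a r"
  by (induction r) (simp_all add: algebra_simps)

lemma subst1_mult: "subst1 a (r * s) = subst1 a r * subst1 a s"
  by (induction r) (simp_all add: subst1_add subst1_smult algebra_simps)

lemma subst2_add: "subst2 a b (F + G) = subst2 a b F + subst2 a b G"
  by (induction F G rule: poly_induct2) (simp_all add: subst1_add algebra_simps)

lemma subst2_smult: "subst2 a b (smult r F) = subst1 a r * subst2 a b F"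
  by (induction F) (simp_all add: subst1_mult algebra_simps)

lemma subst2_mult: "subst2 a b (F * G) = subst2 a b F * subst2 a b G"
  by (induction F) (simp_all add: subst2_add subst2_smult algebra_simps)

lemma subst2_minus: "subst2 a b (- F) = - subst2 a b F"
proof -
  have "subst2 a b (- F) + subst2 a b F = 0"
    by (simp flip: subst2_add)
  then show ?thesis by (simp add: eq_neg_iff_add_eq_0)
qed

lemma subst2_diff: "subst2 a b (F - G) = subst2 a b F - subst2 a b G"
  using subst2_add[of a b F "- G"] by (simp add: subst2_minus)

lemmas subst2_hom = subst2_add subst2_mult subst2_minus subst2_diff

lemma subst2_subst1: "subst2 a b (subst1 F r) = subst1 (subst2 a b F) r"
  by (induction r) (simp_all add: subst2_hom)

section \<open>Generated subalgebras\<close>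

lemma subalgebra_adjoin: "subalgebra (adjoin S)"
  unfolding adjoin_def by (rule hull_in) (fastforce simp: subalgebra_def)

lemma adjoin_gen: "s \<in> S \<Longrightarrow> s \<in> adjoin S"
  unfolding adjoin_def by (rule hull_inc)

lemma adjoin_scal: "scal c \<in> adjoin S"
  and adjoin_add: "F \<in> adjoin S \<Longrightarrow> G \<in> adjoin S \<Longrightarrow> F + G \<in> adjoin S"
  and adjoin_mult: "F \<in> adjoin S \<Longrightarrow> G \<in> adjoin S \<Longrightarrow> F * G \<in> adjoin S"
  using subalgebra_adjoin[of S] by (simp_all add: subalgebra_def)

lemma adjoin_diff:
  assumes "F \<in> adjoin S" "G \<in> adjoin S" shows "F - G \<in> adjoin S"
proof -
  have "F - G = F + scal (- 1) * G"
    by (simp add: poly_eq_iff)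
  then show ?thesis
    using assms adjoin_add adjoin_mult adjoin_scal by metis
qed

lemma adjoin_minimal: "S \<subseteq> A \<Longrightarrow> subalgebra A \<Longrightarrow> adjoin S \<subseteq> A"
  unfolding adjoin_def by (rule hull_minimal)

lemma subst1_in_adjoin: "a \<in> adjoin S \<Longrightarrow> subst1 a r \<in> adjoin S"
proof (induction r)
  case 0
  show ?case using adjoin_scal[of 0 S] by simp
qed (simp_all add: adjoin_add adjoin_mult adjoin_scal)

lemma subst2_in_adjoin:
  "a \<in> adjoin S \<Longrightarrow> b \<in> adjoin S \<Longrightarrow> subst2 a b F \<in> adjoin S"
proof (induction F)
  case 0
  show ?case using adjoin_scal[of 0 S] by simp
qed (simp_all add: adjoin_add adjoin_mult subst1_in_adjoin)

lemma adjoin_singleton: "adjoin {a} = range (subst1 a)"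
proof
  have "a \<in> range (subst1 a)"
    by (rule range_eqI[of _ _ "[:0, 1:]"]) (simp add: pCons_one)
  moreover have "subalgebra (range (subst1 a))"
  proof -
    have "scal c \<in> range (subst1 a)" for c
      by (rule range_eqI[of _ _ "[:c:]"]) simp
    then show ?thesis
      unfolding subalgebra_def by (auto simp flip: subst1_add subst1_mult)
  qed
  ultimately show "adjoin {a} \<subseteq> range (subst1 a)"
    by (intro adjoin_minimal) auto
qed (auto intro: subst1_in_adjoin adjoin_gen)

lemma adjoin_pair: "adjoin {a, b} = range (subst2 a b)"
proof
  have "a \<in> range (subst2 a b)"
    by (rule range_eqI[of _ _ var_x]) (simp add: pCons_one)
  moreover have "b \<in> range (subst2 a b)"
    by (rule range_eqI[of _ _ var_y]) (simp add: pCons_one)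
  moreover have "subalgebra (range (subst2 a b))"
  proof -
    have "scal c \<in> range (subst2 a b)" for c
      by (rule range_eqI[of _ _ "scal c"]) simp
    then show ?thesis
      unfolding subalgebra_def by (auto simp flip: subst2_add subst2_mult)
  qed
  ultimately show "adjoin {a, b} \<subseteq> range (subst2 a b)"
    by (intro adjoin_minimal) auto
qed (auto intro: subst2_in_adjoin adjoin_gen)

lemma adjoin_pair_UNIV_trans:
  assumes "adjoin {a, b} = UNIV" "a \<in> adjoin S" "b \<in> adjoin S"
  shows "adjoin S = UNIV"
  using assms subst2_in_adjoin[of a S b] unfolding adjoin_pair by (metis UNIV_eq_I rangeE UNIV_I)

text \<open>
  A triangular change of generators \<open>(a, b) \<mapsto> (c a + r(b), b)\<close> can be undone.
\<close>

lemma adjoin_triangular: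
  assumes gen: "adjoin {a, b} = UNIV" and c: "c \<noteq> 0"
  shows "adjoin {scal c * a + subst1 b r, b} = UNIV" (is "adjoin ?S = _")
proof (rule adjoin_pair_UNIV_trans[OF gen])
  have "scal (1 / c) * (scal c * a + subst1 b r - subst1 b r) \<in> adjoin ?S"
    by (intro adjoin_mult adjoin_diff adjoin_scal subst1_in_adjoin adjoin_gen) auto
  moreover have "scal (1 / c) * (scal c * a + subst1 b r - subst1 b r) = a"
    using c by (simp add: pCons_one)
  ultimately show "a \<in> adjoin ?S"
    by simp
  show "b \<in> adjoin ?S"
    by (rule adjoin_gen) simp
qed

section \<open>Partial derivatives and the Jacobian determinant\<close>

lemma partial_x_pCons [simp]: "partial_x (pCons r F) = pCons (pderiv r) (partial_x F)"
  by (simp add: partial_x_def map_poly_pCons)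

lemma partial_y_pCons [simp]: "partial_y (pCons r F) = F + pCons 0 (partial_y F)"
  by (simp add: partial_y_def pderiv_pCons)

lemma partial_0 [simp]: "partial_x 0 = 0" "partial_y 0 = 0"
  by (simp_all add: partial_x_def partial_y_def)

lemma coeff_partial_x: "coeff (partial_x F) j = pderiv (coeff F j)"
  by (simp add: partial_x_def coeff_map_poly)

lemma partial_1 [simp]: "partial_x 1 = 0" "partial_y 1 = 0"
  using partial_x_pCons[of 1 0] partial_y_pCons[of 1 0] by (simp_all add: pCons_one)

lemma partial_add:
  "partial_x (F + G) = partial_x F + partial_x G"
  "partial_y (F + G) = partial_y F + partial_y G"
  by (simp_all add: poly_eq_iff coeff_partial_x partial_y_def pderiv_add)

lemma partial_x_smult: "partial_x (smult r F) = smult (pderiv r) F + smult r (partial_x F)"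
  by (simp add: poly_eq_iff[of _ "_ + _"] coeff_partial_x pderiv_mult algebra_simps)

lemma partial_mult:
  "partial_x (F * G) = partial_x F * G + F * partial_x G"
  "partial_y (F * G) = partial_y F * G + F * partial_y G"
proof -
  show "partial_x (F * G) = partial_x F * G + F * partial_x G"
    by (induction F) (simp_all add: partial_add partial_x_smult algebra_simps)
  show "partial_y (F * G) = partial_y F * G + F * partial_y G"
    by (simp add: partial_y_def pderiv_mult algebra_simps)
qed

lemma partial_subst2:
  shows "partial_x (subst2 a b F)
      = subst2 a b (partial_x F) * partial_x a + subst2 a b (partial_y F) * partial_x b"
    and "partial_y (subst2 a b F)
      = subst2 a b (partial_x F) * partial_y a + subst2 a b (partial_y F) * partial_y b"
proof (induction F rule: bivariate_poly_induct)
qed (simp_all add: subst2_hom partial_add partial_mult pderiv_pCons algebra_simps pCons_one)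

definition jac :: "'a::field poly poly \<Rightarrow> 'a poly poly \<Rightarrow> 'a poly poly"
  where "jac p q = partial_x p * partial_y q - partial_y p * partial_x q"

lemma jac_subst2: "jac (subst2 a b F) (subst2 a b G) = subst2 a b (jac F G) * jac a b"
  by (simp add: jac_def partial_subst2 subst2_hom algebra_simps)

lemma unit_scal:
  fixes F :: "'a::field poly poly"
  assumes "F dvd 1"
  obtains c where "c \<noteq> 0" "F = scal c"
proof -
  obtain r where r: "F = [:r:]" "r dvd 1"
    using assms by (auto simp: is_unit_poly_iff)
  then obtain c where "r = [:c:]"
    by (auto simp: is_unit_poly_iff)
  moreover have "F \<noteq> 0" using assms by auto
  ultimately show ?thesis using r that[of c] by auto
qed

lemma jacobian_pair_jac:
  assumes "jacobian_pair p q"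
  obtains c where "c \<noteq> 0" "jac p q = scal c"
proof -
  obtain B where "jacobian_mat p q ** B = mat 1"
    using assms by (auto simp: jacobian_pair_def invertible_def)
  then have "det (jacobian_mat p q) * det B = 1"
    by (metis det_mul det_I)
  moreover have "det (jacobian_mat p q) = jac p q"
    by (simp add: det_2 jacobian_mat_def jac_def)
  ultimately have "jac p q dvd 1"
    by (metis dvd_triv_left)
  then show ?thesis using unit_scal that by blast
qed

text \<open>
  The substitution \<open>x \<mapsto> a, y \<mapsto> b\<close> has a right inverse \<open>x \<mapsto> A, y \<mapsto> B\<close>, so by the chain rule
  the determinant of \<open>(a,b)\<close> divides that of \<open>(x,y)\<close>, which is 1.
\<close>

lemma jac_generators:
  assumes "adjoin {a, b} = UNIV"
  obtains c where "c \<noteq> 0" "jac a b = scal c"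
proof -
  obtain A B where AB: "subst2 a b A = var_x" "subst2 a b B = var_y"
    using assms unfolding adjoin_pair by (metis rangeE UNIV_I)
  have "1 = jac var_x (var_y :: 'a poly poly)"
    by (simp add: jac_def pderiv_pCons one_pCons)
  also have "\<dots> = subst2 a b (jac A B) * jac a b"
    by (simp add: jac_subst2 flip: AB)
  finally have "jac a b dvd 1"
    by (metis dvd_triv_right)
  then show ?thesis using unit_scal that by blast
qed

text \<open>
  Differentiating \<open>F(a,b) = 0\<close> yields a homogeneous linear system for \<open>F\<^sub>x(a,b)\<close> and
  \<open>F\<^sub>y(a,b)\<close> whose determinant is \<open>jac a b\<close>; it is solved by Cramer's rule.
\<close>

lemma subst2_kernel_partial:
  assumes "jac a b \<noteq> 0" "subst2 a b F = 0"
  shows "subst2 a b (partial_x F) = 0" "subst2 a b (partial_y F) = 0"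
proof -
  let ?u = "subst2 a b (partial_x F)" and ?v = "subst2 a b (partial_y F)"
  have x: "?u * partial_x a + ?v * partial_x b = 0"
    and y: "?u * partial_y a + ?v * partial_y b = 0"
    using assms(2) by (simp_all flip: partial_subst2)
  have "?u * jac a b = (?u * partial_x a + ?v * partial_x b) * partial_y b
          - (?u * partial_y a + ?v * partial_y b) * partial_x b"
    by (simp add: jac_def algebra_simps)
  then show "?u = 0" using x y assms(1) by simp
  have "?v * jac a b = (?u * partial_y a + ?v * partial_y b) * partial_x a
          - (?u * partial_x a + ?v * partial_x b) * partial_y a"
    by (simp add: jac_def algebra_simps)
  then show "?v = 0" using x y assms(1) by simp
qed

text \<open>
  A nonzero polynomial of least degree in the kernel would have derivative zero, hence be a
  constant in characteristic 0; but substitution fixes the constants.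
\<close>

lemma subst1_inj_0:
  fixes r :: "'a::field_char_0 poly"
  assumes "jac a b \<noteq> 0" "subst1 a r = 0"
  shows "r = 0"
  using assms(2)
proof (induction "degree r" arbitrary: r rule: less_induct)
  case less
  have "subst1 a (pderiv r) = 0"
    using subst2_kernel_partial(1)[OF assms(1), of "[:r:]"] less.prems by simp
  then have "degree r \<noteq> 0 \<Longrightarrow> pderiv r = 0"
    using less.hyps[of "pderiv r"] by (simp add: degree_pderiv)
  then have "degree r = 0"
    by (auto simp: pderiv_eq_0_iff)
  then obtain c where "r = [:c:]"
    by (auto elim: degree_eq_zeroE)
  then show ?case using less.prems by simp
qed

lemma subst2_inj_0:
  fixes F :: "'a::field_char_0 poly poly"
  assumes "jac a b \<noteq> 0" "subst2 a b F = 0"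
  shows "F = 0"
  using assms(2)
proof (induction "degree F" arbitrary: F rule: less_induct)
  case less
  have "subst2 a b (pderiv F) = 0"
    using subst2_kernel_partial(2)[OF assms(1) less.prems] by (simp add: partial_y_def)
  then have "degree F \<noteq> 0 \<Longrightarrow> pderiv F = 0"
    using less.hyps[of "pderiv F"] by (simp add: degree_pderiv)
  then have "degree F = 0"
    by (auto simp: pderiv_eq_0_iff)
  then obtain r where "F = [:r:]"
    by (auto elim: degree_eq_zeroE)
  then show ?case using less.prems subst1_inj_0[OF assms(1)] by simp
qed

lemma inj_subst2:
  fixes a b :: "'a::field_char_0 poly poly"
  assumes "adjoin {a, b} = UNIV"
  shows "inj (subst2 a b)"
proof (rule injI)
  fix F G
  assume "subst2 a b F = subst2 a b G"
  moreover obtain c where "c \<noteq> 0" "jac a b = scal c"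
    using jac_generators[OF assms] .
  ultimately show "F = G"
    using subst2_inj_0[of a b "F - G"] by (simp add: subst2_diff)
qed

text \<open>
  In characteristic 0 the kernel of \<open>\<partial>/\<partial>x\<close> is \<open>K[y]\<close>, so \<open>F\<close> and \<open>c x\<close> differ by an element
  of \<open>K[y]\<close>.
\<close>

lemma partial_x_scal:
  fixes F :: "'a::field_char_0 poly poly"
  assumes "partial_x F = scal c"
  obtains r where "F = scal c * var_x + subst1 var_y r"
proof -
  have zero: "\<exists>r. G = subst1 var_y r" if "partial_x G = 0" for G :: "'a poly poly"
    using that
  proof (induction G)
    case 0
    show ?case by (rule exI[of _ 0]) simp
  next
    case (pCons s G)
    then obtain r where r: "G = subst1 var_y r" by auto
    obtain k where "s = [:k:]"
      using pCons.prems by (auto simp: pderiv_eq_0_iff elim: degree_eq_zeroE)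
    then show ?case using r by (intro exI[of _ "pCons k r"]) simp
  qed
  have "partial_x (F - scal c * var_x) = 0"
    using assms partial_add(1)[of "F - scal c * var_x" "scal c * var_x"]
    by (simp add: pderiv_pCons)
  then obtain r where "F - scal c * var_x = subst1 var_y r" using zero by blast
  then show ?thesis using that by (metis diff_eq_eq add.commute)
qed

section \<open>Newton polygons of a Jacobian pair\<close>

lemma coeff_mult_bivariate:
  "coeff (coeff (F * G) J) I
     = (\<Sum>(j, i)\<in>{..J} \<times> {..I}. coeff (coeff F j) i * coeff (coeff G (J - j)) (I - i))"
  by (simp add: coeff_mult coeff_sum sum.cartesian_product)

text \<open>
  The Euler operators \<open>x \<partial>/\<partial>x\<close> and \<open>y \<partial>/\<partial>y\<close> act diagonally on monomials. For this reason it is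
  \<open>x y\<close> times the Jacobian determinant whose coefficients are computed: its factors need no
  shift of exponents.
\<close>

lemma coeff_euler_x: "coeff (coeff (var_x * partial_x F) j) i = of_nat i * coeff (coeff F j) i"
  by (cases i) (simp_all add: coeff_partial_x coeff_pderiv)

lemma coeff_euler_y: "coeff (coeff (var_y * partial_y F) j) i = of_nat j * coeff (coeff F j) i"
proof (cases j)
  case (Suc k)
  have "coeff (coeff (var_y * partial_y F) j) i = coeff (of_nat (Suc k) * coeff F (Suc k)) i"
    by (simp add: Suc partial_y_def coeff_pderiv)
  also have "\<dots> = of_nat j * coeff (coeff F j) i"
    unfolding Suc of_nat_poly by simp
  finally show ?thesis .
qed simp

text \<open>
  The pair of monomials \<open>x\<^sup>i y\<^sup>j\<close>, \<open>x\<^bsup>i'\<^esup> y\<^bsup>j'\<^esup>\<close> contributes with the factor \<open>i j' - j i'\<close>, the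
  determinant of the two exponent vectors.
\<close>

lemma coeff_jac:
  "coeff (coeff (var_x * var_y * jac P Q) J) I
     = (\<Sum>(j, i)\<in>{..J} \<times> {..I}. (of_nat (i * (J - j)) - of_nat (j * (I - i)))
          * (coeff (coeff P j) i * coeff (coeff Q (J - j)) (I - i)))"
proof -
  have "var_x * var_y * jac P Q
      = (var_x * partial_x P) * (var_y * partial_y Q)
        - (var_y * partial_y P) * (var_x * partial_x Q)"
    unfolding jac_def by (simp only: algebra_simps)
  then show ?thesis
    unfolding coeff_diff
    by (simp only: coeff_diff coeff_euler_x coeff_euler_y
        coeff_mult_bivariate[of "var_x * partial_x P"]
        coeff_mult_bivariate[of "var_y * partial_y P"]
        flip: sum_subtractf) (auto intro!: sum.cong simp: algebra_simps simp del: mult_pCons_left)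
qed

definition monomials :: "'a::field poly poly \<Rightarrow> (nat \<times> nat) set"
  where "monomials F = {(i, j). coeff (coeff F j) i \<noteq> 0}"

lemma finite_monomials: "finite (monomials F)"
proof (rule finite_subset)
  show "monomials F \<subseteq> (\<Union>j\<le>degree F. (\<lambda>i. (i, j)) ` {..degree (coeff F j)})"
  proof
    fix u assume "u \<in> monomials F"
    then obtain i j where u: "u = (i, j)" "coeff (coeff F j) i \<noteq> 0"
      by (auto simp: monomials_def)
    then have "j \<le> degree F" "i \<le> degree (coeff F j)"
      by (auto intro!: le_degree)
    then show "u \<in> (\<Union>j\<le>degree F. (\<lambda>i. (i, j)) ` {..degree (coeff F j)})"
      using u by blast
  qed
qed simp

text \<open>
  If two monomials have independent exponent vectors and the sum of these vectors arises in no
  other way, then nothing cancels their contribution to \<open>x y\<close> times the determinant. When the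
  determinant is constant, that contribution must sit at the monomial \<open>x y\<close>.
\<close>

lemma jac_vertex:
  fixes P Q :: "'a::field_char_0 poly poly"
  assumes jac: "jac P Q = scal c"
    and P: "(i1, j1) \<in> monomials P" and Q: "(i2, j2) \<in> monomials Q"
    and unique: "\<And>i j i' j'. (i, j) \<in> monomials P \<Longrightarrow> (i', j') \<in> monomials Q \<Longrightarrow>
      i + i' = i1 + i2 \<Longrightarrow> j + j' = j1 + j2 \<Longrightarrow> i = i1 \<and> j = j1"
    and det: "i1 * j2 \<noteq> j1 * i2"
  shows "i1 + i2 = 1 \<and> j1 + j2 = 1"
proof -
  let ?I = "i1 + i2" and ?J = "j1 + j2"
  have monomial: "var_x * var_y * scal c = [:0, [:0, c:]:]"
    by simp
  define t where "t j i = (of_nat (i * (?J - j)) - of_nat (j * (?I - i)))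
          * (coeff (coeff P j) i * coeff (coeff Q (?J - j)) (?I - i))" for j i
  have "coeff (coeff (var_x * var_y * jac P Q) ?J) ?I
      = (\<Sum>(j, i)\<in>{..?J} \<times> {..?I}. t j i)"
    by (simp only: coeff_jac t_def)
  also have "\<dots> = (\<Sum>(j, i)\<in>{(j1, i1)}. t j i)"
  proof (rule sum.mono_neutral_right)
    have "t j i = 0" if "j \<le> ?J" "i \<le> ?I" "(j, i) \<noteq> (j1, i1)" for j i
    proof (rule ccontr)
      assume "t j i \<noteq> 0"
      then have "(i, j) \<in> monomials P" "(?I - i, ?J - j) \<in> monomials Q"
        by (auto simp: t_def monomials_def)
      then show False
        using unique[of i j "?I - i" "?J - j"] that by simp
    qed
    then show "\<forall>x\<in>{..?J} \<times> {..?I} - {(j1, i1)}. (case x of (j, i) \<Rightarrow> t j i) = 0"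
      by auto
  qed auto
  also have "\<dots> \<noteq> 0"
    using P Q det by (simp add: t_def monomials_def flip: of_nat_mult)
  finally have "coeff (coeff (var_x * var_y * scal c) ?J) ?I \<noteq> 0"
    unfolding jac .
  then have "coeff (coeff [:0, [:0, c:]:] ?J) ?I \<noteq> 0"
    unfolding monomial .
  then show ?thesis
    by (auto simp: coeff_pCons split: nat.splits)
qed

text \<open>
  The lines through \<open>(1,0)\<close> and \<open>(0,1)\<close> with direction \<open>(m,n)\<close> support the Newton polygons of
  \<open>P\<close> and \<open>Q\<close>. The farthest monomials \<open>(i\<^sub>1,j\<^sub>1)\<close> and \<open>(i\<^sub>2,j\<^sub>2)\<close> on these lines satisfy the
  uniqueness required in \<open>jac_vertex\<close>: a decomposition of their sum must use monomials on both
  lines, and neither can lie farther out. As the offsets from \<open>(1,0)\<close> and \<open>(0,1)\<close> are parallel,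
  the determinant of the exponent vectors is \<open>i\<^sub>1 + j\<^sub>2 - 1 > 0\<close>. By \<open>jac_vertex\<close> the farthest
  monomials are then \<open>x\<close> and \<open>y\<close> themselves.
\<close>

lemma jac_edge:
  fixes P Q :: "'a::field_char_0 poly poly" and m n :: int
  assumes jac: "jac P Q = scal c"
    and n: "n > 0" and m: "m \<ge> 0"
    and P: "\<And>i j. (i, j) \<in> monomials P \<Longrightarrow> n * (int i - 1) \<le> m * int j"
    and Q: "\<And>i j. (i, j) \<in> monomials Q \<Longrightarrow> n * int i \<le> m * (int j - 1)"
    and Q_pos: "\<And>i j. (i, j) \<in> monomials Q \<Longrightarrow> j > 0"
    and x: "(1, 0) \<in> monomials P" and y: "(0, 1) \<in> monomials Q"
  shows "(i, j) \<in> monomials P \<Longrightarrow> n * (int i - 1) = m * int j \<Longrightarrow> j = 0"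
    and "(i, j) \<in> monomials Q \<Longrightarrow> n * int i = m * (int j - 1) \<Longrightarrow> j = 1"
proof -
  define EP where "EP = {(i, j) \<in> monomials P. n * (int i - 1) = m * int j}"
  define EQ where "EQ = {(i, j) \<in> monomials Q. n * int i = m * (int j - 1)}"
  have "finite EP" "finite EQ"
    unfolding EP_def EQ_def by (auto intro: finite_subset[OF _ finite_monomials])
  have "(1, 0) \<in> EP" "(0, 1) \<in> EQ"
    using x y by (auto simp: EP_def EQ_def)
  obtain i1 j1 where 1: "(i1, j1) \<in> EP" and max1: "\<And>i j. (i, j) \<in> EP \<Longrightarrow> j \<le> j1"
  proof -
    have "Max (snd ` EP) \<in> snd ` EP"
      using \<open>finite EP\<close> \<open>(1, 0) \<in> EP\<close> by (intro Max_in) auto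
    then obtain i1 where "(i1, Max (snd ` EP)) \<in> EP" by force
    moreover have "j \<le> Max (snd ` EP)" if "(i, j) \<in> EP" for i j
      using \<open>finite EP\<close> that by (intro Max_ge) force+
    ultimately show ?thesis using that by blast
  qed
  obtain i2 j2 where 2: "(i2, j2) \<in> EQ" and max2: "\<And>i j. (i, j) \<in> EQ \<Longrightarrow> j \<le> j2"
  proof -
    have "Max (snd ` EQ) \<in> snd ` EQ"
      using \<open>finite EQ\<close> \<open>(0, 1) \<in> EQ\<close> by (intro Max_in) auto
    then obtain i2 where "(i2, Max (snd ` EQ)) \<in> EQ" by force
    moreover have "j \<le> Max (snd ` EQ)" if "(i, j) \<in> EQ" for i j
      using \<open>finite EQ\<close> that by (intro Max_ge) force+
    ultimately show ?thesis using that by blast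
  qed
  have e1: "n * (int i1 - 1) = m * int j1" and e2: "n * int i2 = m * (int j2 - 1)"
    and m1: "(i1, j1) \<in> monomials P" and m2: "(i2, j2) \<in> monomials Q"
    using 1 2 by (auto simp: EP_def EQ_def)
  have "i1 \<ge> 1"
  proof -
    have "n * (int i1 - 1) \<ge> 0" using e1 m by simp
    then show ?thesis using n by (simp add: zero_le_mult_iff)
  qed
  have "j2 \<ge> 1" using Q_pos[OF m2] by simp
  have "i1 + i2 = 1 \<and> j1 + j2 = 1"
  proof (rule jac_vertex[OF jac m1 m2])
    fix i j i' j'
    assume p: "(i, j) \<in> monomials P" and q: "(i', j') \<in> monomials Q"
      and I: "i + i' = i1 + i2" and J: "j + j' = j1 + j2"
    have "int i + int i' = int i1 + int i2" "int j + int j' = int j1 + int j2"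
      using I J by linarith+
    then have i': "int i' = int i1 + int i2 - int i" and j': "int j' = int j1 + int j2 - int j"
      by simp_all
    \<comment> \<open>Two nonpositive weights with sum zero both vanish.\<close>
    have "(n * (int i - 1) - m * int j) + (n * int i' - m * (int j' - 1)) = 0"
      using e1 e2 unfolding i' j' by (simp add: algebra_simps)
    then have "n * (int i - 1) = m * int j" "n * int i' = m * (int j' - 1)"
      using P[OF p] Q[OF q] by linarith+
    then have "(i, j) \<in> EP" "(i', j') \<in> EQ"
      using p q by (auto simp: EP_def EQ_def)
    then have "j = j1"
      using max1 max2 J by (metis add_le_cancel_left add_le_cancel_right le_antisym)
    then have "n * (int i - 1) = n * (int i1 - 1)"
      using \<open>n * (int i - 1) = m * int j\<close> e1 by simp
    then show "i = i1 \<and> j = j1"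
      using n \<open>j = j1\<close> by simp
  next
    have "n * ((int i1 - 1) * (int j2 - 1)) = n * (int j1 * int i2)"
    proof -
      have "n * ((int i1 - 1) * (int j2 - 1)) = (n * (int i1 - 1)) * (int j2 - 1)"
        by simp
      also have "\<dots> = int j1 * (m * (int j2 - 1))"
        unfolding e1 by simp
      also have "\<dots> = n * (int j1 * int i2)"
        unfolding e2[symmetric] by simp
      finally show ?thesis .
    qed
    then have "(int i1 - 1) * (int j2 - 1) = int j1 * int i2"
      using n by simp
    then have "int (i1 * j2) = int (j1 * i2) + int i1 + int j2 - 1"
      by (simp add: algebra_simps)
    then show "i1 * j2 \<noteq> j1 * i2"
      using \<open>i1 \<ge> 1\<close> \<open>j2 \<ge> 1\<close> by linarith
  qed
  then have "j1 = 0" "j2 = 1"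
    using \<open>j2 \<ge> 1\<close> by auto
  then show "(i, j) \<in> monomials P \<Longrightarrow> n * (int i - 1) = m * int j \<Longrightarrow> j = 0"
    and "(i, j) \<in> monomials Q \<Longrightarrow> n * int i = m * (int j - 1) \<Longrightarrow> j = 1"
    using max1[of i j] max2[of i j] Q_pos[of i j] by (auto simp: EP_def EQ_def)
qed

text \<open>
  A polynomial map with constant nonzero Jacobian determinant that embeds the line \<open>y = 0\<close> linearly
  into itself is triangular. Otherwise choose, among the offsets of monomials of \<open>P\<close> from \<open>(1,0)\<close>
  and of monomials of \<open>Q\<close> from \<open>(0,1)\<close>, one with the largest ratio \<open>u/v\<close> of its
  components, among those with \<open>u \<ge> 0\<close> and \<open>v > 0\<close>. It spans supporting lines of both
  polygons, against \<open>jac_edge\<close>.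
\<close>

lemma jac_straight_on_axis:
  fixes P Q :: "'a::field_char_0 poly poly"
  assumes jac: "jac P Q = scal c" and c: "c \<noteq> 0"
    and P0: "degree (coeff P 0) \<le> 1" and Q0: "coeff Q 0 = 0"
  obtains a d where "partial_x P = scal a" "a \<noteq> 0" "Q = scal d * var_y" "d \<noteq> 0"
proof -
  obtain b a where ab: "coeff P 0 = [:b, a:]"
  proof -
    have "coeff P 0 = [:coeff (coeff P 0) 0, coeff (coeff P 0) 1:]"
      using P0 by (auto simp: poly_eq_iff coeff_pCons coeff_eq_0 split: nat.splits)
    then show ?thesis using that by blast
  qed
  \<comment> \<open>On the line \<open>y = 0\<close> the determinant is \<open>P\<^sub>x Q\<^sub>y\<close>, because \<open>Q\<close> vanishes there.\<close>
  have "coeff (jac P Q) 0 = smult a (coeff Q 1)"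
    by (simp add: jac_def coeff_mult coeff_partial_x partial_y_def coeff_pderiv ab Q0 pderiv_pCons)
  then have Q1': "smult a (coeff Q 1) = [:c:]"
    using jac by simp
  then have a: "a \<noteq> 0"
    using c by auto
  define d where "d = c / a"
  have d: "d \<noteq> 0" and Q1: "coeff Q 1 = [:d:]"
  proof -
    show "d \<noteq> 0" using a c by (simp add: d_def)
    have "coeff Q 1 = smult (1 / a) (smult a (coeff Q 1))" using a by simp
    then show "coeff Q 1 = [:d:]" unfolding Q1' by (simp add: d_def)
  qed
  have Q_pos: "j > 0" if "(i, j) \<in> monomials Q" for i j
    using that Q0 by (cases j) (auto simp: monomials_def)
  have x: "(1, 0) \<in> monomials P" and y: "(0, 1) \<in> monomials Q"
    using ab Q1 a d by (simp_all add: monomials_def)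
  \<comment> \<open>\<open>V\<close> collects the offsets from the base monomials \<open>x\<close> and \<open>y\<close>, and \<open>W\<close> those to be excluded.
    No offset has \<open>v = 0\<close> and \<open>u > 0\<close>, so the largest slope in \<open>W\<close> bounds all of \<open>V\<close>.\<close>
  define V where "V = (\<lambda>(i, j). (int i - 1, int j)) ` monomials P
    \<union> (\<lambda>(i, j). (int i, int j - 1)) ` monomials Q"
  define W where "W = {(u, v) \<in> V. u \<ge> 0 \<and> v > 0}"
  have V_nonneg: "v \<ge> 0" if "(u, v) \<in> V" for u v
    using that Q_pos by (fastforce simp: V_def)
  have V_axis: "u \<le> 0" if "(u, 0) \<in> V" for u
    using that ab Q1
    by (auto simp: V_def monomials_def coeff_pCons split: nat.splits if_splits)
  have "W = {}"
  proof (rule ccontr)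
    assume "W \<noteq> {}"
    moreover have "finite W"
      unfolding W_def V_def by (rule finite_subset[of _ V]) (auto simp: V_def finite_monomials)
    moreover define slope :: "int \<times> int \<Rightarrow> real" where "slope = (\<lambda>(u, v). of_int u / of_int v)"
    ultimately have "Max (slope ` W) \<in> slope ` W" "\<And>w. w \<in> W \<Longrightarrow> slope w \<le> Max (slope ` W)"
      by simp_all
    then obtain m n where mn: "(m, n) \<in> W" and max: "\<And>w. w \<in> W \<Longrightarrow> slope w \<le> slope (m, n)"
      by force
    then have m: "m \<ge> 0" and n: "n > 0"
      by (auto simp: W_def)
    have V: "n * u \<le> m * v" if uv: "(u, v) \<in> V" for u v
    proof (cases "u \<ge> 0 \<and> v > 0")
      case True
      then have "slope (u, v) \<le> slope (m, n)"
        using max uv by (auto simp: W_def)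
      then have "real_of_int (n * u) \<le> real_of_int (m * v)"
        using True n by (simp add: slope_def field_simps)
      then show ?thesis by linarith
    next
      case False
      then have "u \<le> 0"
        using V_nonneg[OF uv] V_axis[of u] uv by force
      then have "n * u \<le> 0" "0 \<le> m * v"
        using n m V_nonneg[OF uv] by (simp_all add: mult_le_0_iff)
      then show ?thesis by linarith
    qed
    have P: "n * (int i - 1) \<le> m * int j" if "(i, j) \<in> monomials P" for i j
      by (rule V) (use that in \<open>force simp: V_def\<close>)
    have Q: "n * int i \<le> m * (int j - 1)" if "(i, j) \<in> monomials Q" for i j
      by (rule V) (use that in \<open>force simp: V_def\<close>)
    from mn consider i j where "(i, j) \<in> monomials P" "m = int i - 1" "n = int j"
      | i j where "(i, j) \<in> monomials Q" "m = int i" "n = int j - 1"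
      by (auto simp: W_def V_def)
    then show False
    proof cases
      case 1
      have "n * (int i - 1) = m * int j"
        using 1 by simp
      have "j = 0"
        by (rule jac_edge(1)[OF jac n m]) (fact P Q Q_pos x y 1 \<open>n * (int i - 1) = m * int j\<close>)+
      then show False using 1 n by simp
    next
      case 2
      have "n * int i = m * (int j - 1)"
        using 2 by simp
      have "j = 1"
        by (rule jac_edge(2)[OF jac n m]) (fact P Q Q_pos x y 2 \<open>n * int i = m * (int j - 1)\<close>)+
      then show False using 2 n by simp
    qed
  qed
  have P_mono: "i = 0 \<or> j = 0" if "(i, j) \<in> monomials P" for i j
  proof (rule ccontr)
    assume "\<not> (i = 0 \<or> j = 0)"
    then have "(int i - 1, int j) \<in> W"
      using that by (force simp: W_def V_def)
    then show False using \<open>W = {}\<close> by simp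
  qed
  have Q_mono: "j = 1" if "(i, j) \<in> monomials Q" for i j
  proof (rule ccontr)
    assume "j \<noteq> 1"
    then have "(int i, int j - 1) \<in> W"
      using that Q_pos[OF that] by (force simp: W_def V_def)
    then show False using \<open>W = {}\<close> by simp
  qed
  have "coeff (partial_x P) j = coeff (scal a) j" for j
  proof (cases "j = 0")
    case True
    then show ?thesis by (simp add: coeff_partial_x ab pderiv_pCons)
  next
    case False
    then have "coeff (coeff P j) (Suc i) = 0" for i
      using P_mono[of "Suc i" j] by (auto simp: monomials_def)
    then have "pderiv (coeff P j) = 0"
      by (simp add: poly_eq_iff coeff_pderiv)
    then show ?thesis using False by (simp add: coeff_partial_x coeff_pCons split: nat.splits)
  qed
  then have "partial_x P = scal a" by (simp add: poly_eq_iff)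
  moreover have "coeff Q j = coeff (scal d * var_y) j" for j
  proof (cases "j = 1")
    case True
    then show ?thesis using Q1 by simp
  next
    case False
    then have "coeff Q j = 0"
      using Q_mono[of _ j] by (auto simp: monomials_def poly_eq_iff)
    then show ?thesis using False by (auto simp: coeff_pCons split: nat.splits)
  qed
  then have "Q = scal d * var_y" by (simp add: poly_eq_iff)
  ultimately show ?thesis using that a d by blast
qed


text \<open>
  By the chain rule the two determinants differ by the unit \<open>jac a b\<close>; injectivity of the
  substitution then removes it from the determinant of \<open>(P,Q)\<close>.
\<close>

lemma jac_transport:
  fixes a b :: "'a::field_char_0 poly poly"
  assumes gen: "adjoin {a, b} = UNIV"
    and jac: "jac (subst2 a b P) (subst2 a b Q) = scal c" and c: "c \<noteq> 0"
  obtains d where "jac P Q = scal d" "d \<noteq> 0"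
proof -
  obtain k where k: "k \<noteq> 0" "jac a b = scal k"
    using jac_generators[OF gen] .
  have "scal k * subst2 a b (jac P Q) = scal c"
    using jac k by (simp add: jac_subst2 mult.commute)
  then have "scal (1 / k) * (scal k * subst2 a b (jac P Q)) = scal (1 / k) * scal c"
    by (simp only:)
  then have "subst2 a b (jac P Q) = scal (c / k)"
    using k by (simp add: pCons_one)
  then have "subst2 a b (jac P Q) = subst2 a b (scal (c / k))"
    by simp
  then have "jac P Q = scal (c / k)"
    using inj_subst2[OF gen] by (rule injD[rotated])
  then show ?thesis using that k c by simp
qed

lemma jac_diff_subst1: "jac P (Q - subst1 P r) = jac P Q"
proof -
  have "jac P (subst1 P r) = 0"
    by (induction r) (simp_all add: jac_def partial_add partial_mult algebra_simps)
  moreover have "jac P (Q - subst1 P r + subst1 P r) = jac P (Q - subst1 P r) + jac P (subst1 P r)"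
    unfolding jac_def partial_add by (simp only: algebra_simps)
  ultimately show ?thesis by simp
qed

lemma coeff_0_subst1: "coeff (subst1 P r) 0 = pcompose r (coeff P 0)"
  by (induction r) (simp_all add: coeff_mult pcompose_pCons)

section \<open>The two criteria\<close>

text \<open>
  The hypothesis says that \<open>p\<close> maps the coordinate line \<open>g = 0\<close> isomorphically onto the affine
  line. In coordinates \<open>(h,g)\<close> this makes \<open>p(x,0)\<close> linear, so the pair can be brought into the
  form treated by \<open>jac_straight_on_axis\<close>.
\<close>

lemma generate_if_onto_line:
  fixes p q g :: "'a::field_char_0 poly poly"
  assumes jac: "jacobian_pair p q"
    and g: "coordinate_polynomial g" and onto: "UNIV = adjoin {p} + ideal_generated g"
  shows "adjoin {p, q} = UNIV"
proof -
  obtain h where hg: "adjoin {h, g} = UNIV"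
    using g by (auto simp: coordinate_polynomial_def insert_commute)
  have surj: "\<exists>F'. F = subst2 h g F'" for F
    using hg unfolding adjoin_pair by (metis UNIV_I rangeE)
  obtain P Q where P: "p = subst2 h g P" and Q: "q = subst2 h g Q"
    using surj by meson
  obtain c where "c \<noteq> 0" "jac p q = scal c"
    using jacobian_pair_jac[OF jac] .
  then obtain c where c: "c \<noteq> 0" "jac P Q = scal c"
    using jac_transport[OF hg, of P Q] P Q by metis
  have "h \<in> adjoin {p} + ideal_generated g"
    using onto by blast
  then obtain r s where h: "h = subst1 p r + s * g"
    by (auto simp: adjoin_singleton ideal_generated_eq set_plus_def)
  obtain S where S: "s = subst2 h g S"
    using surj by blast
  have "subst2 h g (subst1 P r + S * var_y) = subst1 p r + s * g"
    unfolding P S by (simp add: subst2_hom subst2_subst1 pCons_one)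
  then have "subst2 h g var_x = subst2 h g (subst1 P r + S * var_y)"
    unfolding h[symmetric] by (simp add: pCons_one)
  then have X: "var_x = subst1 P r + S * var_y"
    using inj_subst2[OF hg] by (rule injD[rotated])
  have comp: "pcompose r (coeff P 0) = [:0, 1:]"
  proof -
    have "coeff var_x 0 = coeff (subst1 P r + S * var_y) 0"
      by (simp only: X[symmetric])
    then show ?thesis by (simp add: coeff_0_subst1 coeff_mult)
  qed
  then have "degree r * degree (coeff P 0) = 1"
    by (metis degree_pcompose degree_pCons_eq_if one_neq_zero degree_1 One_nat_def pCons_one)
  then have P0: "degree (coeff P 0) = 1"
    by simp
  \<comment> \<open>Since \<open>r\<close> is the compositional inverse of \<open>p(x,0)\<close>, the polynomial \<open>R(P)\<close> agrees with \<open>Q\<close> on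
    the line \<open>y = 0\<close>.\<close>
  define R where "R = pcompose (coeff Q 0) r"
  define Q' where "Q' = Q - subst1 P R"
  have "pcompose R (coeff P 0) = coeff Q 0"
    by (simp add: R_def comp flip: pcompose_assoc)
  then have "coeff Q' 0 = 0"
    by (simp add: Q'_def coeff_0_subst1)
  moreover have "jac P Q' = scal c"
    by (simp add: Q'_def jac_diff_subst1 c)
  ultimately obtain a d where ad: "partial_x P = scal a" "a \<noteq> 0" "Q' = scal d * var_y" "d \<noteq> 0"
    using jac_straight_on_axis[of P Q' c] c(1) eq_imp_le[OF P0] by blast
  obtain B where B: "P = scal a * var_x + subst1 var_y B"
    using partial_x_scal[OF ad(1)] .
  have p: "p = scal a * h + subst1 g B"
    unfolding P B by (simp add: subst2_hom subst2_subst1 pCons_one)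
  have "adjoin {p, g} = UNIV"
    unfolding p by (rule adjoin_triangular[OF hg ad(2)])
  moreover have "q = scal d * g + subst1 p R"
  proof -
    have "Q = scal d * var_y + subst1 P R"
      using ad(3) unfolding Q'_def by (metis diff_eq_eq)
    then show ?thesis
      unfolding Q by (simp add: subst2_hom subst2_subst1 pCons_one flip: P)
  qed
  ultimately show ?thesis
    using adjoin_triangular[of g p d R] ad(4) by (simp add: insert_commute)
qed

text \<open>
  This is the irreducibility of \<open>y + r(x)\<close>: a factor of degree 0 in \<open>y\<close> divides the leading
  coefficient 1.
\<close>

lemma factor_of_graph:
  fixes A B :: "'a::field poly poly"
  assumes "A * B = [:r, 1:]" "degree A = 0"
  obtains c where "c \<noteq> 0" "A = scal c"
proof -
  obtain s where A: "A = [:s:]"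
    using assms(2) by (auto elim: degree_eq_zeroE)
  have "s * coeff B 1 = coeff (A * B) 1"
    by (simp add: A)
  also have "\<dots> = 1"
    by (simp add: assms)
  finally have "s dvd 1"
    by (metis dvd_triv_left)
  then have "A dvd 1"
    using A is_unit_poly_iff by blast
  then show ?thesis using unit_scal that by blast
qed

text \<open>
  The hypothesis says that \<open>g\<close> maps the curve \<open>p = 0\<close> isomorphically onto the affine line. The
  curve is then the graph of a polynomial in \<open>g\<close>, which makes \<open>p\<close> a coordinate.
\<close>

lemma generate_if_line_onto:
  fixes p q g :: "'a::field_char_0 poly poly"
  assumes jac: "jacobian_pair p q"
    and g: "coordinate_polynomial g" and onto: "UNIV = adjoin {g} + ideal_generated p"
  shows "adjoin {p, q} = UNIV"
proof -
  obtain h where gh: "adjoin {g, h} = UNIV"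
    using g by (auto simp: coordinate_polynomial_def)
  obtain c where c: "c \<noteq> 0" "jac p q = scal c"
    using jacobian_pair_jac[OF jac] .
  have surj: "\<exists>F'. F = subst2 g h F'" for F
    using gh unfolding adjoin_pair by (metis UNIV_I rangeE)
  have "h \<in> adjoin {g} + ideal_generated p"
    using onto by blast
  then obtain r s where h: "h = subst1 g r + s * p"
    by (auto simp: adjoin_singleton ideal_generated_eq set_plus_def)
  obtain P S where P: "p = subst2 g h P" and S: "s = subst2 g h S"
    using surj by meson
  have "subst2 g h ([:r:] + S * P) = subst1 g r + s * p"
    unfolding P S by (simp add: subst2_hom)
  then have "subst2 g h var_y = subst2 g h ([:r:] + S * P)"
    unfolding h[symmetric] by (simp add: pCons_one)
  then have "var_y = [:r:] + S * P"
    using inj_subst2[OF gh] by (rule injD[rotated])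
  then have SP: "S * P = [:- r, 1:]"
  proof -
    have "S * P = var_y - [:r:]"
      using \<open>var_y = [:r:] + S * P\<close> by (metis add_diff_cancel_left')
    then show ?thesis by simp
  qed
  then have "degree (S * P) = 1" "S \<noteq> 0" "P \<noteq> 0"
    by auto
  then have "degree S + degree P = 1"
    by (simp add: degree_mult_eq)
  moreover have "degree P \<noteq> 0"
  proof
    assume "degree P = 0"
    moreover have "P * S = [:- r, 1:]"
      using SP by (simp only: mult.commute)
    ultimately obtain k where "P = scal k"
      using factor_of_graph by blast
    then have "p = scal k"
      using P by simp
    then have "jac p q = 0"
      by (simp add: jac_def)
    then show False using c by simp
  qed
  ultimately have "degree S = 0"
    by linarith
  then obtain k where k: "k \<noteq> 0" "S = scal k"
    using factor_of_graph[OF SP] by blast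
  then have s: "s = scal k"
    using S by simp
  have gp: "adjoin {g, p} = UNIV"
  proof (rule adjoin_pair_UNIV_trans[OF gh])
    show "g \<in> adjoin {g, p}" by (simp add: adjoin_gen)
    show "h \<in> adjoin {g, p}"
      by (subst h, subst s)
        (intro adjoin_add adjoin_mult subst1_in_adjoin adjoin_scal adjoin_gen; simp)
  qed
  obtain Q where Q: "q = subst2 g p Q"
    using gp unfolding adjoin_pair by (metis UNIV_I rangeE)
  have "jac q p = - jac p q"
    by (simp add: jac_def)
  then have "jac (subst2 g p Q) (subst2 g p var_y) = scal (- c)"
    by (simp add: c(2) pCons_one flip: Q)
  moreover have "- c \<noteq> 0"
    using c(1) by simp
  ultimately obtain d where d: "jac Q var_y = scal d" "d \<noteq> 0"
    using jac_transport[OF gp] by blast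
  then have "partial_x Q = scal d"
    by (simp add: jac_def pCons_one)
  then obtain B where "Q = scal d * var_x + subst1 var_y B"
    using partial_x_scal by blast
  then have q: "q = scal d * g + subst1 p B"
    unfolding Q by (simp add: subst2_hom subst2_subst1 pCons_one)
  then show ?thesis
    using adjoin_triangular[OF gp d(2)] by (simp add: insert_commute)
qed

text \<open>
  Modulo \<open>q\<close>, a polynomial in \<open>p\<close> and \<open>q\<close> is a polynomial in \<open>p\<close> alone.
\<close>

lemma onto_line_if_generate:
  assumes "adjoin {p, q} = UNIV"
  shows "UNIV = adjoin {p} + ideal_generated q"
proof -
  have "F \<in> adjoin {p} + ideal_generated q" for F
  proof -
    obtain F' where F: "F = subst2 p q F'"
      using assms unfolding adjoin_pair by (metis UNIV_I rangeE)
    obtain r G where "F' = pCons r G" by (cases F')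
    then have "F = subst1 p r + subst2 p q G * q"
      by (simp add: F)
    then show ?thesis
      by (auto simp: adjoin_singleton ideal_generated_eq set_plus_def)
  qed
  then show ?thesis by blast
qed

theorem corollary1p4:
  shows "((\<forall>p q :: 'a::field_char_0 poly poly. jacobian_pair p q \<longrightarrow>
            (\<exists>g. coordinate_polynomial g \<and> UNIV = adjoin {p} + ideal_generated g))
          \<longleftrightarrow>
          (\<forall>p q :: 'a poly poly. jacobian_pair p q \<longrightarrow> adjoin {p, q} = UNIV))
       \<and>
         ((\<forall>p q :: 'a poly poly. jacobian_pair p q \<longrightarrow>
            (\<exists>g. coordinate_polynomial g \<and> UNIV = adjoin {g} + ideal_generated p))
          \<longleftrightarrow>
          (\<forall>p q :: 'a poly poly. jacobian_pair p q \<longrightarrow> adjoin {p, q} = UNIV))"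
proof -
  have "coordinate_polynomial q \<and> UNIV = adjoin {p} + ideal_generated q
      \<and> UNIV = adjoin {q} + ideal_generated p"
    if "adjoin {p, q} = UNIV" for p q :: "'a poly poly"
    using that onto_line_if_generate[of p q] onto_line_if_generate[of q p]
    by (auto simp: coordinate_polynomial_def insert_commute)
  then show ?thesis
    using generate_if_onto_line[where 'a = 'a] generate_if_line_onto[where 'a = 'a] by meson
qed

end
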